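(* Let $d\ge1$, $r\in(0,+\infty)$, let $\|\cdot\|$ be a norm on $\mathbb{R}^d$, and let $P$ be a Borel probability measure on $\mathbb{R}^d$ with $\int\|x\|^r\,dP(x)<+\infty$. Let $s\in(r,d+r)$ and let $(a_n)_{n\ge1}$ be an $L^r$-optimal greedy quantization sequence for $P$, $a^{(n)}=\{a_1,\dots,a_n\}$. Let $\varepsilon\in(0,\tfrac13)$, let $\nu$ be a probability distribution on $\mathbb{R}^d$ and $g_\varepsilon:\mathbb{R}^d\to\mathbb{R}_+$ a Borel function such that for every $x\in\operatorname{supp}(P)$ and every $t\in[0,\varepsilon\|x-a_1\|]$, $\nu(B(x,t))\ge g_\varepsilon(x)V_dt^d$. Then for every $n\ge3$, $$e_s(a^{(n)},P)\le\kappa^{\mathrm{Greedy}}_{d,r,\varepsilon}\Big(\int g_\varepsilon^{-\frac{s}{d+r-s}}dP\Big)^{\frac{d+r-s}{s(d+r)}}\Big(\int g_\varepsilon^{-\frac rd}dP\Big)^{\frac1{d+r}}(n-2)^{-\frac1d},$$ where $\kappa^{\mathrm{Greedy}}_{d,r,\varepsilon}=2^{\frac1d}\big(\frac rd\big)^{\frac{r}{d(d+r)}}V_d^{-\frac1d}\varphi_r(\varepsilon)^{-\frac1d}$.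
   Context: For a finite nonempty $\Gamma\subset\mathbb{R}^d$ and $p>0$, $d(x,\Gamma)=\min_{a\in\Gamma}\|x-a\|$ and $e_p(\Gamma,P)=\big(\int d(x,\Gamma)^p dP(x)\big)^{1/p}$. An $L^r$-optimal greedy quantization sequence for $P$ is a sequence $(a_n)_{n\ge1}$ with $a_{n+1}\in\operatorname{argmin}_{\xi\in\mathbb{R}^d}e_r(a^{(n)}\cup\{\xi\},P)$ for all $n\ge0$, where $a^{(0)}=\varnothing$ and $a^{(n)}=\{a_1,\dots,a_n\}$ (so $a_1$ is an $L^r$-median of $P$). $B(x,t)=\{y:\|y-x\|\le t\}$, $V_d=\lambda_d(B(0,1))$ with $\lambda_d$ Lebesgue measure, $\varphi_r(u)=(3^{-r}-u^r)u^d$. *)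

theory Defs
  imports "HOL-Analysis.Analysis" "HOL-Probability.Probability"
begin

definition is_norm :: "('a::real_vector \<Rightarrow> real) \<Rightarrow> bool" where
  "is_norm N \<longleftrightarrow> (\<forall>x. N x = 0 \<longleftrightarrow> x = 0) \<and> (\<forall>x y. N (x + y) \<le> N x + N y)
     \<and> (\<forall>c x. N (c *\<^sub>R x) = \<bar>c\<bar> * N x)"

definition nball :: "('a::real_vector \<Rightarrow> real) \<Rightarrow> 'a \<Rightarrow> real \<Rightarrow> 'a set" where
  "nball N x t = {y. N (y - x) \<le> t}"

definition unit_ball_vol :: "('a::euclidean_space \<Rightarrow> real) \<Rightarrow> real" where
  "unit_ball_vol N = measure lborel (nball N 0 1)"

definition dist_set :: "('a::real_vector \<Rightarrow> real) \<Rightarrow> 'a \<Rightarrow> 'a set \<Rightarrow> real" where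
  "dist_set N x \<Gamma> = Min ((\<lambda>a. N (x - a)) ` \<Gamma>)"

text \<open>Positive real power on [0,\<infinity>], with \<infinity> powr p = \<infinity> (used only for p > 0).\<close>
definition epowr :: "ennreal \<Rightarrow> real \<Rightarrow> ennreal" where
  "epowr x p = (if x = \<infinity> then \<infinity> else ennreal (enn2real x powr p))"

definition qerr :: "('a::real_vector \<Rightarrow> real) \<Rightarrow> real \<Rightarrow> 'a set \<Rightarrow> 'a measure \<Rightarrow> ennreal" where
  "qerr N p \<Gamma> P = epowr (\<integral>\<^sup>+ x. ennreal (dist_set N x \<Gamma> powr p) \<partial>P) (1 / p)"

definition prefix_set :: "(nat \<Rightarrow> 'a) \<Rightarrow> nat \<Rightarrow> 'a set" where
  "prefix_set a n = a ` {1..n}"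

text \<open>L^r-optimal greedy quantization sequence (indexed from 1).\<close>
definition greedy_seq :: "('a::real_vector \<Rightarrow> real) \<Rightarrow> real \<Rightarrow> 'a measure \<Rightarrow> (nat \<Rightarrow> 'a) \<Rightarrow> bool" where
  "greedy_seq N r P a \<longleftrightarrow>
     (\<forall>n. \<forall>\<xi>. qerr N r (prefix_set a n \<union> {a (Suc n)}) P \<le> qerr N r (prefix_set a n \<union> {\<xi>}) P)"

definition msupp :: "'a::topological_space measure \<Rightarrow> 'a set" where
  "msupp P = {x. \<forall>U. open U \<and> x \<in> U \<longrightarrow> emeasure P U > 0}"

text \<open>g^{-p} with the convention 0^{-p} = \<infinity> (p > 0).\<close>
definition negpow :: "('a \<Rightarrow> real) \<Rightarrow> real \<Rightarrow> 'a \<Rightarrow> ennreal" where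
  "negpow g p x = (if g x = 0 then \<infinity> else ennreal (g x powr (- p)))"

definition phi_r :: "nat \<Rightarrow> real \<Rightarrow> real \<Rightarrow> real" where
  "phi_r d r u = (3 powr (- r) - u powr r) * u ^ d"

definition kappa_greedy :: "nat \<Rightarrow> real \<Rightarrow> real \<Rightarrow> real \<Rightarrow> real" where
  "kappa_greedy d r V \<epsilon> = 2 powr (1 / d) * (r / d) powr (r / (d * (d + r)))
      * V powr (- 1 / d) * phi_r d r \<epsilon> powr (- 1 / d)"

end

theory Submission
  imports Defs
begin

text \<open>
  Let \<open>d\<^sub>n(x)\<close> be the distance from \<open>x\<close> to the first \<open>n\<close> greedy points and
  \<open>A\<^sub>n = \<integral> d\<^sub>n\<^sup>r dP\<close>, \<open>I\<^sub>n = \<integral> g d\<^sub>n\<^bsup>d+r\<^esup> dP\<close>. By greediness, adding any point \<open>y\<close> does not beat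
  the next greedy point; averaging this over \<open>y\<close> with respect to \<open>\<nu>\<close>, and keeping only the \<open>y\<close> in the
  ball of radius \<open>\<epsilon> d\<^sub>n(x)\<close> around \<open>x\<close>, gives \<open>A\<^sub>n\<^sub>+\<^sub>1 + C I\<^sub>n \<le> A\<^sub>n\<close> with \<open>C = V\<^sub>d \<phi>\<^sub>r(\<epsilon>)\<close>.
  Hoelder's inequality bounds \<open>\<integral> d\<^sub>n\<^sup>p dP\<close> for \<open>p < d + r\<close> by \<open>I\<^sub>n\<close> and a negative moment of \<open>g\<close>.
  With \<open>p = r\<close> this closes the recursion and yields \<open>A\<^sub>n = O(n\<^bsup>-r/d\<^esup>)\<close>; since \<open>I\<^sub>n\<close> decreases, summing
  the recursion over the second half of the indices improves it to \<open>I\<^sub>n = O(n\<^bsup>-1-r/d\<^esup>)\<close>, and \<open>p = s\<close>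
  turns this into the claim.
\<close>

subsection \<open>Weighted Hoelder inequality\<close>

text \<open>Young's inequality for \<open>f x / F\<close> and \<open>h x / H\<close>, integrated
  over \<open>M\<close>. If \<open>F\<close> or \<open>H\<close> is zero this normalisation fails,
  but then the integrand vanishes almost everywhere, since \<open>0 powr t = 0\<close>.\<close>

lemma nn_integral_powr_mult_powr_le:
  fixes f h :: "'a \<Rightarrow> real"
  assumes [measurable]: "f \<in> borel_measurable M" "h \<in> borel_measurable M"
    and nonneg: "\<And>x. 0 \<le> f x" "\<And>x. 0 \<le> h x"
    and \<theta>: "0 < \<theta>" "\<theta> < 1"
    and F: "(\<integral>\<^sup>+ x. f x \<partial>M) = ennreal F" "0 \<le> F"
    and H: "(\<integral>\<^sup>+ x. h x \<partial>M) = ennreal H" "0 \<le> H"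
  shows "(\<integral>\<^sup>+ x. f x powr \<theta> * h x powr (1 - \<theta>) \<partial>M) \<le> ennreal (F powr \<theta> * H powr (1 - \<theta>))"
proof (cases "F = 0 \<or> H = 0")
  case True
  then have "AE x in M. f x = 0 \<or> h x = 0"
  proof
    assume "F = 0"
    then have "(\<integral>\<^sup>+ x. f x \<partial>M) = 0" using F by simp
    then have "AE x in M. ennreal (f x) = 0"
      by (subst (asm) nn_integral_0_iff_AE) auto
    then show ?thesis
      by eventually_elim (use nonneg in \<open>auto simp: ennreal_eq_0_iff intro: antisym\<close>)
  next
    assume "H = 0"
    then have "(\<integral>\<^sup>+ x. h x \<partial>M) = 0" using H by simp
    then have "AE x in M. ennreal (h x) = 0"
      by (subst (asm) nn_integral_0_iff_AE) auto
    then show ?thesis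
      by eventually_elim (use nonneg in \<open>auto simp: ennreal_eq_0_iff intro: antisym\<close>)
  qed
  then have "(\<integral>\<^sup>+ x. f x powr \<theta> * h x powr (1 - \<theta>) \<partial>M) = (\<integral>\<^sup>+ x. 0 \<partial>M)"
    by (intro nn_integral_cong_AE) (erule AE_mp, auto)
  then show ?thesis by simp
next
  case False
  then have pos: "F > 0" "H > 0" using F H by auto
  \<comment> \<open>\<open>K\<close> is the claimed bound; multiplying Young's inequality by it
    undoes the normalisation on the left-hand side.\<close>
  define K where "K = F powr \<theta> * H powr (1 - \<theta>)"
  have K: "K > 0" using pos by (simp add: K_def)
  have le: "f x powr \<theta> * h x powr (1 - \<theta>) \<le> K * \<theta> / F * f x + K * (1 - \<theta>) / H * h x" for x
  proof (cases "f x = 0 \<or> h x = 0")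
    case True
    then show ?thesis using pos K \<theta> nonneg[of x] by auto
  next
    case False
    then have fh: "f x > 0" "h x > 0" using nonneg[of x] by auto
    have "(f x / F) powr \<theta> * (h x / H) powr (1 - \<theta>) \<le> \<theta> * (f x / F) + (1 - \<theta>) * (h x / H)"
      using \<theta> fh pos by (intro Youngs_inequality_0) auto
    then have "K * ((f x / F) powr \<theta> * (h x / H) powr (1 - \<theta>)) \<le> K * (\<theta> * (f x / F) + (1 - \<theta>) * (h x / H))"
      using K by simp
    moreover have "K * ((f x / F) powr \<theta> * (h x / H) powr (1 - \<theta>)) = f x powr \<theta> * h x powr (1 - \<theta>)"
      using fh pos by (simp add: K_def powr_divide)
    ultimately show ?thesis by (simp add: algebra_simps)
  qed
  have "(\<integral>\<^sup>+ x. f x powr \<theta> * h x powr (1 - \<theta>) \<partial>M)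
      \<le> (\<integral>\<^sup>+ x. ennreal (K * \<theta> / F) * ennreal (f x) + ennreal (K * (1 - \<theta>) / H) * ennreal (h x) \<partial>M)"
  proof (intro nn_integral_mono)
    fix x
    have "ennreal (K * \<theta> / F) * ennreal (f x) + ennreal (K * (1 - \<theta>) / H) * ennreal (h x)
        = ennreal (K * \<theta> / F * f x + K * (1 - \<theta>) / H * h x)"
      using K \<theta> pos nonneg[of x]
      by (simp add: ennreal_mult[symmetric] ennreal_plus[symmetric] del: ennreal_plus)
    then show "ennreal (f x powr \<theta> * h x powr (1 - \<theta>)) \<le> ennreal (K * \<theta> / F) * ennreal (f x) + ennreal (K * (1 - \<theta>) / H) * ennreal (h x)"
      using le[of x] by (simp add: ennreal_leI)
  qed
  also have "\<dots> = ennreal (K * \<theta> / F) * ennreal F + ennreal (K * (1 - \<theta>) / H) * ennreal H"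
    by (simp add: nn_integral_add nn_integral_cmult F H)
  also have "\<dots> = ennreal (K * \<theta> + K * (1 - \<theta>))"
    using K \<theta> pos by (simp add: ennreal_mult[symmetric] ennreal_plus[symmetric] del: ennreal_plus)
  also have "K * \<theta> + K * (1 - \<theta>) = K" by (simp add: algebra_simps)
  finally show ?thesis by (simp add: K_def)
qed

lemma borel_measurable_negpow [measurable]:
  assumes [measurable]: "g \<in> borel_measurable M"
  shows "negpow g p \<in> borel_measurable M"
  unfolding negpow_def by measurable

text \<open>The powers of \<open>g\<close> cancel in
  \<open>D^p = (g D^q)^(p/q) * (g^(-p/(q-p)))^((q-p)/q)\<close>, to which Hoelder applies with
  \<open>\<theta> = p / q\<close>.\<close>

lemma nn_integral_powr_le_weighted:
  fixes D g :: "'a \<Rightarrow> real"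
  assumes [measurable]: "D \<in> borel_measurable M" "g \<in> borel_measurable M"
    and nonneg: "\<And>x. 0 \<le> D x" "\<And>x. 0 \<le> g x"
    and pq: "0 < p" "p < q"
    and I: "(\<integral>\<^sup>+ x. g x * D x powr q \<partial>M) = ennreal I" "0 \<le> I"
    and G: "(\<integral>\<^sup>+ x. negpow g (p / (q - p)) x \<partial>M) = ennreal G" "0 \<le> G"
  shows "(\<integral>\<^sup>+ x. D x powr p \<partial>M) \<le> ennreal (I powr (p / q) * G powr ((q - p) / q))"
proof -
  \<comment> \<open>\<open>negpow\<close> is infinite at the zeros of \<open>g\<close>, so a finite
    negative moment makes \<open>g\<close> positive almost everywhere, as the cancellation
    requires.\<close>
  have "AE x in M. negpow g (p / (q - p)) x \<noteq> \<infinity>"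
    by (intro nn_integral_noteq_infinite) (auto simp: G)
  then have gpos: "AE x in M. g x > 0"
    by (rule AE_mp) (use nonneg(2) in \<open>auto intro!: AE_I2 simp: negpow_def less_le\<close>)
  have G': "(\<integral>\<^sup>+ x. ennreal (g x powr - (p / (q - p))) \<partial>M) = ennreal G"
    unfolding G(1)[symmetric]
    by (intro nn_integral_cong_AE, use gpos in eventually_elim) (simp add: negpow_def)
  have th: "1 - p / q = (q - p) / q" using pq by (simp add: field_simps)
  have "(\<integral>\<^sup>+ x. D x powr p \<partial>M)
      = (\<integral>\<^sup>+ x. (g x * D x powr q) powr (p / q) * (g x powr - (p / (q - p))) powr (1 - p / q) \<partial>M)"
  proof (intro nn_integral_cong_AE, use gpos in eventually_elim)
    fix x assume g: "g x > 0"
    have "(g x * D x powr q) powr (p / q) * (g x powr - (p / (q - p))) powr (1 - p / q)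
        = g x powr (p / q) * D x powr p * g x powr - (p / q)"
      unfolding th using g pq nonneg(1)[of x] by (simp add: powr_mult powr_powr)
    also have "\<dots> = D x powr p" using g by (simp add: powr_minus)
    finally show "ennreal (D x powr p)
        = ennreal ((g x * D x powr q) powr (p / q) * (g x powr - (p / (q - p))) powr (1 - p / q))"
      by simp
  qed
  also have "\<dots> \<le> ennreal (I powr (p / q) * G powr (1 - p / q))"
    using pq nonneg by (intro nn_integral_powr_mult_powr_le I G' G(2)) auto
  finally show ?thesis unfolding th .
qed

subsection \<open>Decay of recursive sequences\<close>

text \<open>Discrete form of the equation \<open>A' = - c A^(1+\<gamma>)\<close>, whose solutions
  have \<open>A^(-\<gamma>)\<close> growing at rate \<open>\<gamma> c\<close>: here
  \<open>A n powr - \<gamma>\<close> gains at least \<open>\<gamma> * c\<close> per step.\<close>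

lemma powr_decay_of_nonlinear_recursion:
  fixes A :: "nat \<Rightarrow> real"
  assumes \<gamma>: "0 < \<gamma>" and c: "0 < c"
    and nonneg: "\<And>n. 0 \<le> A n"
    and step: "\<And>n. A (Suc n) + c * A n powr (1 + \<gamma>) \<le> A n"
    and n: "0 < n"
  shows "A n \<le> (\<gamma> * c * real n) powr (- 1 / \<gamma>)"
proof (cases "A n = 0")
  case False
  then have An: "A n > 0" using nonneg[of n] by simp
  \<comment> \<open>Positivity is a premise because \<open>0 powr - \<gamma> = 0\<close>. It passes
    from \<open>Suc n\<close> back to \<open>n\<close> since \<open>A\<close> does not
    increase.\<close>
  have inv: "A n > 0 \<Longrightarrow> \<gamma> * c * real n \<le> A n powr - \<gamma>" for n
  proof (induction n)
    case (Suc n)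
    have An: "A n > 0"
      using step[of n] Suc.prems c by (smt (verit) mult_nonneg_nonneg powr_ge_zero)
    define x where "x = c * A n powr \<gamma>"
    have le: "A (Suc n) \<le> A n * (1 - x)"
      using step[of n] An by (simp add: x_def powr_add algebra_simps)
    have "0 < A n * (1 - x)" using le Suc.prems by linarith
    then have x: "0 < x" "x < 1"
      using c An by (auto simp: x_def zero_less_mult_iff)
    \<comment> \<open>Bernoulli's inequality
      \<open>1 + \<gamma> x \<le> (1 - x)^(-\<gamma>)\<close>, with the exponential in between
      because \<open>ln (1 - x) \<le> - x\<close>.\<close>
    have "1 + \<gamma> * x \<le> exp (\<gamma> * x)" by (rule exp_ge_add_one_self)
    also have "\<dots> \<le> (1 - x) powr - \<gamma>"
      using x \<gamma> mult_left_mono[OF ln_le_minus_one[of "1 - x"], of \<gamma>] by (simp add: powr_def)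
    finally have "A n powr - \<gamma> * (1 + \<gamma> * x) \<le> A n powr - \<gamma> * (1 - x) powr - \<gamma>"
      by (intro mult_left_mono) auto
    also have "\<dots> = (A n * (1 - x)) powr - \<gamma>"
      using x An by (simp add: powr_mult)
    also have "\<dots> \<le> A (Suc n) powr - \<gamma>"
      using \<gamma> Suc.prems le by (intro powr_mono2') auto
    finally have "A n powr - \<gamma> * (1 + \<gamma> * x) \<le> A (Suc n) powr - \<gamma>" .
    moreover have "A n powr - \<gamma> * x = c"
      using An by (simp add: x_def powr_minus)
    then have "A n powr - \<gamma> * (1 + \<gamma> * x) = A n powr - \<gamma> + \<gamma> * c"
      by (simp add: algebra_simps)
    ultimately have "A n powr - \<gamma> + \<gamma> * c \<le> A (Suc n) powr - \<gamma>" by simp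
    then show ?case using Suc.IH[OF An] by (simp add: algebra_simps)
  qed simp
  have "A n = (A n powr - \<gamma>) powr (- 1 / \<gamma>)"
    using An \<gamma> by (simp add: powr_powr)
  also have "\<dots> \<le> (\<gamma> * c * real n) powr (- 1 / \<gamma>)"
    using \<gamma> c n inv[OF An] by (intro powr_mono2') auto
  finally show ?thesis .
qed simp

text \<open>Interpolation closes the recursion for \<open>A\<close>, so \<open>A k\<close> is of
  order \<open>k^(-\<beta>)\<close>. From a midpoint \<open>k\<close> up to \<open>n\<close>, every
  step costs at least \<open>C * I n\<close>, and the total cost is at most \<open>A k\<close>; this
  gains one further power of \<open>n\<close> for \<open>I n\<close>.\<close>

lemma dissipation_le:
  fixes A I :: "nat \<Rightarrow> real"
  assumes \<beta>: "0 < \<beta>" and C: "0 < C" and G: "0 < G"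
    and nonneg: "\<And>n. 0 \<le> A n" "\<And>n. 0 \<le> I n"
    and step: "\<And>n. A (Suc n) + C * I n \<le> A n"
    and antimono: "\<And>n. I (Suc n) \<le> I n"
    and interp: "\<And>n. A n \<le> I n powr (\<beta> / (1 + \<beta>)) * G powr (1 / (1 + \<beta>))"
    and n: "2 \<le> n"
  shows "I n \<le> (2 / (C * (real n - 1))) powr (1 + \<beta>) * \<beta> powr \<beta> * G"
proof -
  define c where "c = C * G powr (- 1 / \<beta>)"
  have c: "c > 0" using C G by (simp add: c_def)
  \<comment> \<open>Raised to the power \<open>(1 + \<beta>) / \<beta>\<close>, the interpolation
    bound becomes linear in \<open>I n\<close>; the factor \<open>G powr (- 1 / \<beta>)\<close> in
    \<open>c\<close> cancels what is left of \<open>G\<close>.\<close>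
  have "A (Suc n) + c * A n powr (1 + 1 / \<beta>) \<le> A n" for n
  proof -
    have e: "1 + 1 / \<beta> = (1 + \<beta>) / \<beta>" using \<beta> by (simp add: field_simps)
    have "A n powr (1 + 1 / \<beta>) \<le> (I n powr (\<beta> / (1 + \<beta>)) * G powr (1 / (1 + \<beta>))) powr (1 + 1 / \<beta>)"
      using \<beta> nonneg(1)[of n] interp[of n] by (intro powr_mono2) auto
    also have "\<dots> = I n * G powr (1 / \<beta>)"
      unfolding e using \<beta> nonneg(2)[of n] G by (simp add: powr_mult powr_powr add_pos_pos)
    finally have "c * A n powr (1 + 1 / \<beta>) \<le> c * (I n * G powr (1 / \<beta>))"
      using c by simp
    also have "\<dots> = C * I n" using G by (simp add: c_def powr_minus)
    finally show ?thesis using step[of n] by simp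
  qed
  then have decay: "A k \<le> (1 / \<beta> * c * real k) powr - \<beta>" if "0 < k" for k
    using powr_decay_of_nonlinear_recursion[of "1 / \<beta>" c A k] that \<beta> c nonneg(1) by simp
  \<comment> \<open>Telescoping: each of the \<open>m\<close> dissipation terms is replaced by
    \<open>I (k + m)\<close>, which is below all of them.\<close>
  have tele: "A (k + m) + C * (real m * I (k + m)) \<le> A k" for k m
  proof (induction m)
    case (Suc m)
    have "C * (real m * I (k + Suc m)) \<le> C * (real m * I (k + m))"
      using C antimono[of "k + m"] by (intro mult_left_mono) auto
    moreover have "C * I (k + Suc m) \<le> C * I (k + m)"
      using C antimono[of "k + m"] by simp
    ultimately show ?case
      using Suc step[of "k + m"] by (simp add: algebra_simps)
  qed simp
  define k where "k = n div 2"
  \<comment> \<open>For either parity of \<open>n\<close>, both \<open>k\<close> and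
    \<open>n - k\<close> are at least \<open>y\<close>. This is the origin of the 2 and of
    \<open>real n - 1\<close> in the bound.\<close>
  define y where "y = (real n - 1) / 2"
  have y: "0 < y" "y \<le> real k" "y \<le> real (n - k)"
    using n by (auto simp: y_def k_def)
  have "0 < k" and kn: "k + (n - k) = n" using n by (auto simp: k_def)
  have "C * (y * I n) \<le> C * (real (n - k) * I n)"
    using C y nonneg(2)[of n] by (intro mult_left_mono mult_right_mono) auto
  also have "\<dots> \<le> A k"
    using tele[of k "n - k"] nonneg(1)[of n] unfolding kn by linarith
  also have "\<dots> \<le> (1 / \<beta> * c * real k) powr - \<beta>"
    using decay \<open>0 < k\<close> by blast
  also have "\<dots> \<le> (1 / \<beta> * c * y) powr - \<beta>"
    using \<beta> c y by (intro powr_mono2' mult_left_mono) auto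
  also have "\<dots> = (C * y) powr - \<beta> * \<beta> powr \<beta> * G"
  proof -
    have "(1 / \<beta>) powr - \<beta> = \<beta> powr \<beta>"
      using \<beta> by (simp add: powr_divide powr_minus)
    moreover have "(G powr (- 1 / \<beta>)) powr - \<beta> = G"
      using \<beta> G by (simp add: powr_powr)
    moreover have "1 / \<beta> * c * y = (1 / \<beta>) * (G powr (- 1 / \<beta>)) * (C * y)"
      by (simp add: c_def)
    ultimately show ?thesis
      using \<beta> C G y by (simp only: powr_mult) simp
  qed
  \<comment> \<open>Dividing by \<open>C * y\<close> raises the decay exponent from
    \<open>\<beta>\<close> to \<open>1 + \<beta>\<close>.\<close>
  finally have "I n \<le> (C * y) powr - \<beta> * \<beta> powr \<beta> * G / (C * y)"
    using C y by (simp add: pos_le_divide_eq mult.commute mult.left_commute)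
  also have "\<dots> = (1 / (C * y)) powr (1 + \<beta>) * \<beta> powr \<beta> * G"
    using C y by (simp add: powr_add powr_divide powr_minus field_simps)
  also have "1 / (C * y) = 2 / (C * (real n - 1))"
    by (simp add: y_def)
  finally show ?thesis .
qed

subsection \<open>Norms on Euclidean space\<close>

context
  fixes N :: "'a::euclidean_space \<Rightarrow> real"
  assumes norm: "is_norm N"
begin

lemma is_norm_zero_iff: "N x = 0 \<longleftrightarrow> x = 0"
  and is_norm_triangle: "N (x + y) \<le> N x + N y"
  and is_norm_scaleR: "N (c *\<^sub>R x) = \<bar>c\<bar> * N x"
  using norm by (auto simp: is_norm_def)

lemma is_norm_zero: "N 0 = 0"
  by (simp add: is_norm_zero_iff)

lemma is_norm_minus: "N (- x) = N x"
  using is_norm_scaleR[of "-1" x] by simp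

lemma is_norm_minus_commute: "N (x - y) = N (y - x)"
  using is_norm_minus[of "x - y"] by simp

lemma is_norm_nonneg: "0 \<le> N x"
  using is_norm_triangle[of x "- x"] by (simp add: is_norm_minus is_norm_zero)

text \<open>Triangle inequality along the coordinate expansion; the summand 1 in \<open>B\<close>
  makes its positivity immediate.\<close>

lemma is_norm_le_norm: obtains B where "0 < B" "\<And>x. N x \<le> B * norm x"
proof
  define B where "B = (\<Sum>b\<in>Basis. N (b::'a)) + 1"
  have sum_le: "N (\<Sum>b\<in>S. f b) \<le> (\<Sum>b\<in>S. N (f b))" if "finite S" for S :: "'a set" and f
    using that
  proof induction
    case (insert b S)
    then show ?case using is_norm_triangle[of "f b" "\<Sum>b\<in>S. f b"] by simp
  qed (simp add: is_norm_zero)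
  show "0 < B" by (auto simp: B_def intro!: add_nonneg_pos sum_nonneg is_norm_nonneg)
  fix x
  have "N x = N (\<Sum>b\<in>Basis. (x \<bullet> b) *\<^sub>R b)" by (simp add: euclidean_representation)
  also have "\<dots> \<le> (\<Sum>b\<in>Basis. N ((x \<bullet> b) *\<^sub>R b))" by (rule sum_le) simp
  also have "\<dots> \<le> (\<Sum>b\<in>Basis. N b * norm x)"
    by (intro sum_mono) (simp add: is_norm_scaleR is_norm_nonneg Basis_le_norm mult.commute mult_left_mono)
  also have "\<dots> \<le> B * norm x" by (simp add: B_def sum_distrib_right distrib_right)
  finally show "N x \<le> B * norm x" .
qed

lemma continuous_on_is_norm: "continuous_on S N"
proof -
  obtain B where B: "0 < B" "\<And>x. N x \<le> B * norm x" using is_norm_le_norm by blast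
  have "\<bar>N x - N y\<bar> \<le> B * norm (x - y)" for x y
    using is_norm_triangle[of "x - y" y] is_norm_triangle[of "y - x" x] is_norm_minus_commute[of x y] B(2)[of "x - y"]
    by (simp add: abs_le_iff)
  then have "B-lipschitz_on S N"
    using B by (intro lipschitz_onI) (auto simp: dist_norm)
  then show ?thesis by (rule lipschitz_on_continuous_on)
qed

lemma is_norm_measurable [measurable]: "N \<in> borel_measurable borel"
  by (intro borel_measurable_continuous_onI continuous_on_is_norm)

text \<open>The continuous function \<open>N\<close> attains a positive minimum on the compact
  Euclidean unit sphere; homogeneity extends the bound to all vectors.\<close>

lemma is_norm_ge_norm: obtains c where "0 < c" "\<And>x. c * norm x \<le> N x"
proof -
  have "\<exists>x\<in>sphere (0::'a) 1. \<forall>y\<in>sphere 0 1. N x \<le> N y"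
    by (intro continuous_attains_inf continuous_on_is_norm) auto
  then obtain u where u: "norm u = 1" "\<And>y. norm y = 1 \<Longrightarrow> N u \<le> N y" by auto
  have "0 < N u" using u(1) is_norm_nonneg[of u] is_norm_zero_iff[of u] by (auto simp: less_le)
  moreover have "N u * norm x \<le> N x" for x
  proof (cases "x = 0")
    case False
    then have "N u \<le> N ((1 / norm x) *\<^sub>R x)" by (intro u) simp
    then show ?thesis using False by (simp add: is_norm_scaleR field_simps)
  qed (simp add: is_norm_zero)
  ultimately show ?thesis by (rule that)
qed

text \<open>A Euclidean ball inside gives positive volume, and one outside gives finite volume;
  without the latter, \<open>measure\<close> could return its default value 0.\<close>

lemma unit_ball_vol_pos: "0 < unit_ball_vol N"
proof -
  obtain B where B: "0 < B" "\<And>x. N x \<le> B * norm x" using is_norm_le_norm by blast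
  obtain c where c: "0 < c" "\<And>x. c * norm x \<le> N x" using is_norm_ge_norm by blast
  have sub: "ball 0 (1 / B) \<subseteq> nball N 0 1"
  proof
    fix x :: 'a assume "x \<in> ball 0 (1 / B)"
    then have "B * norm x \<le> 1" using B by (simp add: field_simps)
    then show "x \<in> nball N 0 1" using B(2)[of x] by (simp add: nball_def)
  qed
  have "nball N 0 1 \<subseteq> cball 0 (1 / c)"
  proof
    fix x :: 'a assume "x \<in> nball N 0 1"
    then have "c * norm x \<le> 1" using c(2)[of x] by (simp add: nball_def)
    then show "x \<in> cball 0 (1 / c)" using c by (simp add: field_simps)
  qed
  then have bdd: "bounded (nball N 0 1)" using bounded_cball bounded_subset by blast
  have [measurable]: "nball N 0 1 \<in> sets borel" by (simp add: nball_def)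
  have "0 < measure lborel (ball (0::'a) (1 / B))"
    using B content_ball_pos[of "1 / B" "0::'a"] by (simp add: measure_completion)
  also have "\<dots> \<le> measure lborel (nball N 0 1)"
    using sub emeasure_bounded_finite[OF bdd] by (intro measure_mono_fmeasurable)
       (auto simp: fmeasurable_def)
  finally show ?thesis by (simp add: unit_ball_vol_def)
qed

section \<open>Distance to a finite set, and moments about a point\<close>

lemma dist_set_insert:
  assumes "finite \<Gamma>" "\<Gamma> \<noteq> {}"
  shows "dist_set N x (insert b \<Gamma>) = min (N (x - b)) (dist_set N x \<Gamma>)"
  using assms by (simp add: dist_set_def)

lemma dist_set_nonneg: "finite \<Gamma> \<Longrightarrow> \<Gamma> \<noteq> {} \<Longrightarrow> 0 \<le> dist_set N x \<Gamma>"
  by (simp add: dist_set_def is_norm_nonneg)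

lemma dist_set_le: "finite \<Gamma> \<Longrightarrow> b \<in> \<Gamma> \<Longrightarrow> dist_set N x \<Gamma> \<le> N (x - b)"
  by (simp add: dist_set_def)

lemma dist_set_measurable [measurable]:
  assumes "finite \<Gamma>" "\<Gamma> \<noteq> {}"
  shows "(\<lambda>x. dist_set N x \<Gamma>) \<in> borel_measurable borel"
  using assms
proof (induction rule: finite_ne_induct)
  case (singleton b)
  then show ?case by (simp add: dist_set_def)
next
  case (insert b \<Gamma>)
  have [measurable]: "(\<lambda>x. dist_set N x \<Gamma>) \<in> borel_measurable borel" by (rule insert)
  show ?case using insert by (simp add: dist_set_insert)
qed

lemma moment_translate_finite:
  assumes r: "0 < r" and P: "prob_space P" and sets_P: "sets P = sets borel"
    and moment: "(\<integral>\<^sup>+ x. N x powr r \<partial>P) < \<infinity>"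
  shows "(\<integral>\<^sup>+ x. N (x - b) powr r \<partial>P) < \<infinity>"
proof -
  interpret prob_space P by fact
  note [measurable_cong] = sets_P
  have le: "N (x - b) powr r \<le> 2 powr r * N x powr r + 2 powr r * N b powr r" for x
  proof -
    have "N (x - b) \<le> N x + N b" using is_norm_triangle[of x "- b"] by (simp add: is_norm_minus)
    also have "\<dots> \<le> 2 * max (N x) (N b)" by simp
    finally have "N (x - b) powr r \<le> (2 * max (N x) (N b)) powr r"
      using r is_norm_nonneg by (intro powr_mono2) auto
    also have "\<dots> = 2 powr r * max (N x) (N b) powr r"
      using is_norm_nonneg[of x] by (simp add: powr_mult)
    also have "\<dots> \<le> 2 powr r * (N x powr r + N b powr r)"
      by (intro mult_left_mono) (auto simp: max_def)
    finally show ?thesis by (simp add: distrib_left)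
  qed
  have "(\<integral>\<^sup>+ x. N (x - b) powr r \<partial>P)
      \<le> (\<integral>\<^sup>+ x. ennreal (2 powr r) * ennreal (N x powr r) + ennreal (2 powr r * N b powr r) \<partial>P)"
    using le by (intro nn_integral_mono) (simp add: ennreal_mult[symmetric] ennreal_plus[symmetric] ennreal_leI del: ennreal_plus)
  also have "\<dots> = ennreal (2 powr r) * (\<integral>\<^sup>+ x. N x powr r \<partial>P) + ennreal (2 powr r * N b powr r)"
    by (simp add: nn_integral_add nn_integral_cmult emeasure_space_1)
  also have "\<dots> < \<infinity>"
    using moment by (simp add: ennreal_mult_less_top)
  finally show ?thesis .
qed

end

subsection \<open>The greedy step\<close>

text \<open>The complement of the support is a union of open null sets; by Lindelof a countable
  subfamily covers it.\<close>

lemma AE_in_msupp: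
  fixes P :: "'a::second_countable_topology measure"
  assumes "sets P = sets borel"
  shows "AE x in P. x \<in> msupp P"
proof -
  define \<F> where "\<F> = {U. open U \<and> emeasure P U = 0}"
  obtain \<F>' where \<F>': "\<F>' \<subseteq> \<F>" "countable \<F>'" "\<Union>\<F>' = \<Union>\<F>"
    by (rule Lindelof[of \<F>]) (auto simp: \<F>_def)
  have "\<Union>\<F>' \<in> null_sets P"
    using \<F>' assms by (intro null_sets_UN'[where N = "\<lambda>U. U", simplified]) (auto simp: \<F>_def null_sets_def)
  then have "AE x in P. x \<notin> \<Union>\<F>'" by (rule AE_not_in)
  then show ?thesis
    by eventually_elim (unfold \<F>'(3), auto simp: msupp_def \<F>_def zero_less_iff_neq_zero)
qed

text \<open>Removes the outer root in \<open>qerr\<close>, so that greedy optimality compares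
  integrals.\<close>

lemma epowr_le_cancel:
  assumes "0 < p" "epowr x p \<le> epowr y p"
  shows "x \<le> y"
proof (cases "y = \<infinity>")
  case False
  then have "x \<noteq> \<infinity>" using assms(2) by (auto simp: epowr_def top_unique)
  have "enn2real x powr p \<le> enn2real y powr p"
    using assms(2) False \<open>x \<noteq> \<infinity>\<close> by (simp add: epowr_def)
  then have "enn2real x \<le> enn2real y"
    using assms(1) powr_less_mono2[of p "enn2real y" "enn2real x"] by (meson enn2real_nonneg not_less)
  then show ?thesis using False \<open>x \<noteq> \<infinity>\<close> by (metis ennreal_enn2real_if ennreal_leI infinity_ennreal_def)
qed simp

lemma epowr_mono: "0 \<le> p \<Longrightarrow> x \<le> y \<Longrightarrow> epowr x p \<le> epowr y p"
  by (auto simp: epowr_def top_unique intro!: ennreal_leI powr_mono2 enn2real_mono simp: less_top)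

lemma epowr_ennreal: "0 \<le> x \<Longrightarrow> epowr (ennreal x) p = ennreal (x powr p)"
  by (simp add: epowr_def)

lemma greedy_step:
  fixes N :: "'a::euclidean_space \<Rightarrow> real" and g :: "'a \<Rightarrow> real"
  defines "d \<equiv> DIM('a)"
  assumes norm: "is_norm N" and r: "0 < r"
    and P: "prob_space P" "sets P = sets borel"
    and nu: "prob_space \<nu>" "sets \<nu> = sets borel"
    and eps: "0 < \<epsilon>" "\<epsilon> < 1 / 3"
    and g_meas: "g \<in> borel_measurable borel"
    and g_nonneg: "\<And>x. 0 \<le> g x"
    and \<Gamma>: "finite \<Gamma>" "c \<in> \<Gamma>"
    and g_bound: "\<forall>x \<in> msupp P. \<forall>t. 0 \<le> t \<and> t \<le> \<epsilon> * N (x - c) \<longrightarrow>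
                    measure \<nu> (nball N x t) \<ge> g x * unit_ball_vol N * t ^ d"
    and opt: "\<And>\<xi>. (\<integral>\<^sup>+ x. dist_set N x (insert b \<Gamma>) powr r \<partial>P)
                     \<le> (\<integral>\<^sup>+ x. dist_set N x (insert \<xi> \<Gamma>) powr r \<partial>P)"
  shows "(\<integral>\<^sup>+ x. dist_set N x (insert b \<Gamma>) powr r \<partial>P)
       + ennreal (unit_ball_vol N * phi_r d r \<epsilon>) * (\<integral>\<^sup>+ x. g x * dist_set N x \<Gamma> powr (d + r) \<partial>P)
       \<le> (\<integral>\<^sup>+ x. dist_set N x \<Gamma> powr r \<partial>P)"
proof -
  interpret P: prob_space P by fact
  interpret \<nu>: prob_space \<nu> by fact
  interpret pair_sigma_finite P \<nu> ..
  note [measurable_cong] = P(2) nu(2)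
  note [measurable] = is_norm_measurable[OF norm] g_meas
  have ne: "\<Gamma> \<noteq> {}" using \<Gamma> by auto
  define D where "D x = dist_set N x \<Gamma>" for x
  have D0: "0 \<le> D x" for x using dist_set_nonneg[OF norm] \<Gamma> ne by (simp add: D_def)
  have [measurable]: "D \<in> borel_measurable borel"
    unfolding D_def using dist_set_measurable[OF norm \<Gamma>(1) ne] by simp
  define V where "V = unit_ball_vol N"
  have V: "0 < V" using unit_ball_vol_pos[OF norm] by (simp add: V_def)
  define C where "C = V * phi_r d r \<epsilon>"
  have epsr: "\<epsilon> powr r \<le> 3 powr - r"
  proof -
    have "\<epsilon> powr r \<le> (1 / 3) powr r" using eps r by (intro powr_mono2) auto
    then show ?thesis by (simp add: powr_divide powr_minus field_simps)
  qed
  have C: "0 \<le> C" using V eps epsr by (simp add: C_def phi_r_def)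
  define A where "A = (\<integral>\<^sup>+ x. dist_set N x (insert b \<Gamma>) powr r \<partial>P)"
  \<comment> \<open>\<open>ennreal\<close> sends negative reals to 0, so \<open>h x y\<close> is the
    positive part: the decrease of the cost at \<open>x\<close> when \<open>y\<close> is added to
    \<open>\<Gamma>\<close>.\<close>
  define h where "h x y = ennreal (D x powr r - N (x - y) powr r)" for x y
  have h_meas [measurable]: "case_prod h \<in> borel_measurable (P \<Otimes>\<^sub>M \<nu>)"
    unfolding h_def by measurable
  have gain: "A + (\<integral>\<^sup>+ x. h x y \<partial>P) \<le> (\<integral>\<^sup>+ x. D x powr r \<partial>P)" for y
  proof -
    have "A + (\<integral>\<^sup>+ x. h x y \<partial>P) \<le> (\<integral>\<^sup>+ x. min (N (x - y)) (D x) powr r \<partial>P) + (\<integral>\<^sup>+ x. h x y \<partial>P)"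
      using opt[of y] \<Gamma> ne by (simp add: A_def dist_set_insert[OF norm] D_def add_right_mono)
    also have "\<dots> = (\<integral>\<^sup>+ x. ennreal (min (N (x - y)) (D x) powr r) + h x y \<partial>P)"
      unfolding h_def by (rule nn_integral_add[symmetric]) measurable
    also have "\<dots> = (\<integral>\<^sup>+ x. D x powr r \<partial>P)"
    proof (rule nn_integral_cong)
      fix x
      show "ennreal (min (N (x - y)) (D x) powr r) + h x y = ennreal (D x powr r)"
      proof (cases "N (x - y) \<le> D x")
        case True
        then have "N (x - y) powr r \<le> D x powr r"
          using r is_norm_nonneg[OF norm] by (intro powr_mono2) auto
        with True show ?thesis
          by (simp add: h_def ennreal_plus[symmetric] del: ennreal_plus)
      next
        case False
        then have "D x powr r \<le> N (x - y) powr r"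
          using r D0 by (intro powr_mono2) auto
        with False show ?thesis by (simp add: h_def ennreal_neg)
      qed
    qed
    finally show ?thesis .
  qed
  have inner: "ennreal (C * (g x * D x powr (d + r))) \<le> (\<integral>\<^sup>+ y. h x y \<partial>\<nu>)" if x: "x \<in> msupp P" for x
  proof -
    define t where "t = \<epsilon> * D x"
    have t: "0 \<le> t" "t \<le> \<epsilon> * N (x - c)"
      using eps D0[of x] dist_set_le[OF norm \<Gamma>, of x] by (auto simp: t_def D_def)
    have [measurable]: "nball N x t \<in> sets borel" by (simp add: nball_def)
    have "C * (g x * D x powr (d + r)) = (3 powr - r - \<epsilon> powr r) * D x powr r * (g x * V * t ^ d)"
    proof (cases "D x = 0")
      case False
      then have "0 < D x" using D0[of x] by simp
      then have "D x powr (d + r) = D x ^ d * D x powr r"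
        by (simp only: powr_add powr_realpow)
      then show ?thesis unfolding C_def phi_r_def t_def power_mult_distrib by (simp only: mult_ac)
    qed simp
    \<comment> \<open>As \<open>3 powr - r \<le> 1\<close>, the factor occurring in
      \<open>phi_r\<close> lies below \<open>1 - \<epsilon> powr r\<close>, the relative gain
      available on the ball.\<close>
    also have "\<dots> \<le> ((1 - \<epsilon> powr r) * D x powr r) * measure \<nu> (nball N x t)"
    proof (intro mult_mono)
      have "(3::real) powr - r \<le> 3 powr 0" using r by (intro powr_mono) auto
      then show "3 powr - r - \<epsilon> powr r \<le> 1 - \<epsilon> powr r"
        and "0 \<le> (1 - \<epsilon> powr r)" using epsr by simp_all
      then show "0 \<le> (1 - \<epsilon> powr r) * D x powr r" by simp
      show "g x * V * t ^ d \<le> measure \<nu> (nball N x t)"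
        using g_bound x t by (simp add: V_def)
    qed (use g_nonneg V t in auto)
    finally have "ennreal (C * (g x * D x powr (d + r)))
        \<le> ennreal (((1 - \<epsilon> powr r) * D x powr r) * measure \<nu> (nball N x t))"
      by (rule ennreal_leI)
    also have "\<dots> = (\<integral>\<^sup>+ y. ennreal ((1 - \<epsilon> powr r) * D x powr r) * indicator (nball N x t) y \<partial>\<nu>)"
      by (simp add: nn_integral_cmult_indicator \<nu>.emeasure_eq_measure ennreal_mult'')
    also have "\<dots> \<le> (\<integral>\<^sup>+ y. h x y \<partial>\<nu>)"
    proof (intro nn_integral_mono)
      fix y
      show "ennreal ((1 - \<epsilon> powr r) * D x powr r) * indicator (nball N x t) y \<le> h x y"
      proof (cases "y \<in> nball N x t")
        case True
        then have "N (x - y) \<le> t" using is_norm_minus_commute[OF norm, of x y] by (simp add: nball_def)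
        then have "N (x - y) powr r \<le> t powr r"
          using r is_norm_nonneg[OF norm] by (intro powr_mono2) auto
        also have "\<dots> = \<epsilon> powr r * D x powr r"
          using eps D0[of x] by (simp add: t_def powr_mult)
        finally show ?thesis using True
          by (auto simp: h_def algebra_simps intro!: ennreal_leI)
      qed simp
    qed
    finally show ?thesis .
  qed
  have "ennreal C * (\<integral>\<^sup>+ x. g x * D x powr (d + r) \<partial>P) = (\<integral>\<^sup>+ x. ennreal (C * (g x * D x powr (d + r))) \<partial>P)"
    using C g_nonneg by (subst nn_integral_cmult[symmetric]) (auto simp: ennreal_mult)
  also have "\<dots> \<le> (\<integral>\<^sup>+ x. (\<integral>\<^sup>+ y. h x y \<partial>\<nu>) \<partial>P)"
    using AE_in_msupp[OF P(2)] inner by (intro nn_integral_mono_AE) (auto elim!: AE_mp)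
  \<comment> \<open>Tonelli: the gain is bounded below for fixed \<open>x\<close>, while optimality
    bounds it above for fixed \<open>y\<close>. As \<open>\<nu>\<close> has mass one, averaging over
    \<open>y\<close> leaves the constants unchanged.\<close>
  also have "\<dots> = (\<integral>\<^sup>+ y. (\<integral>\<^sup>+ x. h x y \<partial>P) \<partial>\<nu>)"
    by (rule Fubini'[symmetric]) simp
  finally have "A + ennreal C * (\<integral>\<^sup>+ x. g x * D x powr (d + r) \<partial>P) \<le> A + (\<integral>\<^sup>+ y. (\<integral>\<^sup>+ x. h x y \<partial>P) \<partial>\<nu>)"
    by (rule add_left_mono)
  also have "\<dots> = (\<integral>\<^sup>+ y. A + (\<integral>\<^sup>+ x. h x y \<partial>P) \<partial>\<nu>)"
    by (subst nn_integral_add) (auto simp: \<nu>.emeasure_space_1)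
  also have "\<dots> \<le> (\<integral>\<^sup>+ y. (\<integral>\<^sup>+ x. D x powr r \<partial>P) \<partial>\<nu>)"
    by (intro nn_integral_mono gain)
  also have "\<dots> = (\<integral>\<^sup>+ x. D x powr r \<partial>P)" by (simp add: \<nu>.emeasure_space_1)
  finally show ?thesis by (simp add: A_def C_def V_def D_def)
qed

section \<open>Assembling the error bound\<close>

lemma epowr_eq_0_iff: "epowr x p = 0 \<longleftrightarrow> x = 0"
  by (auto simp: epowr_def ennreal_eq_0_iff enn2real_eq_0_iff)

text \<open>\<open>negpow\<close> vanishes nowhere. This excludes products
  \<open>0 * \<infinity> = 0\<close> on the right-hand side of the theorem.\<close>

lemma nn_integral_negpow_neq_0:
  assumes "prob_space P" "g \<in> borel_measurable P"
  shows "(\<integral>\<^sup>+ x. negpow g p x \<partial>P) \<noteq> 0"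
proof
  interpret prob_space P by fact
  note [measurable] = assms(2)
  assume "(\<integral>\<^sup>+ x. negpow g p x \<partial>P) = 0"
  then have "AE x in P. negpow g p x = 0"
    by (subst (asm) nn_integral_0_iff_AE) auto
  then have "AE x in P. False"
    by (rule AE_mp) (auto simp: negpow_def ennreal_eq_0_iff split: if_splits)
  then show False by simp
qed

lemma prefix_set_Suc: "prefix_set a (Suc n) = insert (a (Suc n)) (prefix_set a n)"
  by (simp add: prefix_set_def atLeastAtMostSuc_conv)

theorem theorem3p1:
  fixes N :: "'a::euclidean_space \<Rightarrow> real"
    and P \<nu> :: "'a measure"
    and r s \<epsilon> :: real
    and a :: "nat \<Rightarrow> 'a"
    and g :: "'a \<Rightarrow> real"
  defines "d \<equiv> DIM('a)"
  assumes norm: "is_norm N"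
    and r: "0 < r"
    and P: "prob_space P" "sets P = sets borel"
    and moment: "(\<integral>\<^sup>+ x. ennreal (N x powr r) \<partial>P) < \<infinity>"
    and s: "r < s" "s < d + r"
    and greedy: "greedy_seq N r P a"
    and eps: "0 < \<epsilon>" "\<epsilon> < 1 / 3"
    and nu: "prob_space \<nu>" "sets \<nu> = sets borel"
    and g_meas: "g \<in> borel_measurable borel"
    and g_nonneg: "\<forall>x. 0 \<le> g x"
    and g_bound: "\<forall>x \<in> msupp P. \<forall>t. 0 \<le> t \<and> t \<le> \<epsilon> * N (x - a 1) \<longrightarrow>
                    measure \<nu> (nball N x t) \<ge> g x * unit_ball_vol N * t ^ d"
  shows "\<forall>n \<ge> 3. qerr N s (prefix_set a n) P \<le>
           ennreal (kappa_greedy d r (unit_ball_vol N) \<epsilon>)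
           * epowr (\<integral>\<^sup>+ x. negpow g (s / (d + r - s)) x \<partial>P) ((d + r - s) / (s * (d + r)))
           * epowr (\<integral>\<^sup>+ x. negpow g (r / d) x \<partial>P) (1 / (d + r))
           * ennreal ((real n - 2) powr (- 1 / d))"
proof (intro allI impI)
  fix n :: nat assume n: "3 \<le> n"
  note [measurable_cong] = P(2)
  note [measurable] = g_meas
  define V where "V = unit_ball_vol N"
  define C where "C = V * phi_r d r \<epsilon>"
  define \<kappa> where "\<kappa> = kappa_greedy d r V \<epsilon>"
  define GG where "GG = (\<integral>\<^sup>+ x. negpow g (r / d) x \<partial>P)"
  define HH where "HH = (\<integral>\<^sup>+ x. negpow g (s / (d + r - s)) x \<partial>P)"
  have d: "0 < real d" by (simp add: d_def)
  have V: "0 < V" using unit_ball_vol_pos[OF norm] by (simp add: V_def)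
  have \<phi>: "0 < phi_r d r \<epsilon>"
  proof -
    have "\<epsilon> powr r < (1 / 3) powr r" using eps r by (intro powr_less_mono2) auto
    then show ?thesis using eps by (simp add: phi_r_def powr_divide powr_minus field_simps)
  qed
  have C: "0 < C" using V \<phi> by (simp add: C_def)
  have \<kappa>: "0 < \<kappa>" using V \<phi> r d by (simp add: \<kappa>_def kappa_greedy_def)
  have nz: "GG \<noteq> 0" "HH \<noteq> 0"
    unfolding GG_def HH_def by (intro nn_integral_negpow_neq_0[OF P(1)]; measurable)+
  show "qerr N s (prefix_set a n) P \<le>
           ennreal (kappa_greedy d r (unit_ball_vol N) \<epsilon>)
           * epowr (\<integral>\<^sup>+ x. negpow g (s / (d + r - s)) x \<partial>P) ((d + r - s) / (s * (d + r)))
           * epowr (\<integral>\<^sup>+ x. negpow g (r / d) x \<partial>P) (1 / (d + r))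
           * ennreal ((real n - 2) powr (- 1 / d))"
    unfolding GG_def[symmetric] HH_def[symmetric] V_def[symmetric] \<kappa>_def[symmetric]
  proof (cases "GG = \<infinity> \<or> HH = \<infinity>")
    \<comment> \<open>No factor is zero, so one infinite factor makes the whole right-hand side
      infinite.\<close>
    case True
    have "epowr GG (1 / (d + r)) \<noteq> 0" "epowr HH ((d + r - s) / (s * (d + r))) \<noteq> 0"
      using nz by (simp_all add: epowr_eq_0_iff)
    moreover have "epowr GG (1 / (d + r)) = \<infinity> \<or> epowr HH ((d + r - s) / (s * (d + r))) = \<infinity>"
      using True by (auto simp: epowr_def)
    moreover have "ennreal \<kappa> \<noteq> 0" "ennreal ((real n - 2) powr (- 1 / d)) \<noteq> 0"
      using \<kappa> n by (simp_all add: ennreal_eq_0_iff not_le)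
    ultimately have "ennreal \<kappa> * epowr HH ((d + r - s) / (s * (d + r))) * epowr GG (1 / (d + r))
        * ennreal ((real n - 2) powr (- 1 / d)) = \<infinity>"
      by (auto simp: ennreal_top_mult ennreal_mult_top ennreal_mult_eq_top_iff)
    then show "qerr N s (prefix_set a n) P \<le> ennreal \<kappa> * epowr HH ((d + r - s) / (s * (d + r)))
        * epowr GG (1 / (d + r)) * ennreal ((real n - 2) powr (- 1 / d))" by simp
  next
    case False
    then obtain G H where GH: "GG = ennreal G" "HH = ennreal H" "0 \<le> G" "0 \<le> H"
      by (metis ennreal_cases infinity_ennreal_def)
    then have pos: "0 < G" "0 < H" using nz by (auto simp: less_le)
    \<comment> \<open>Index \<open>k\<close> belongs to the first \<open>Suc k\<close> points, so
      the set is never empty and always contains \<open>a 1\<close>.\<close>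
    define D where "D k x = dist_set N x (prefix_set a (Suc k))" for k x
    have fin: "finite (prefix_set a (Suc k))" and a1: "a 1 \<in> prefix_set a (Suc k)" for k
      by (auto simp: prefix_set_def)
    have ne: "prefix_set a (Suc k) \<noteq> {}" for k using a1[of k] by blast
    have D0: "0 \<le> D k x" for k x unfolding D_def by (rule dist_set_nonneg[OF norm fin ne])
    have [measurable]: "D k \<in> borel_measurable borel" for k
      unfolding D_def by (rule dist_set_measurable[OF norm fin ne])
    have D_Suc: "D (Suc k) x \<le> D k x" for k x
      unfolding D_def prefix_set_Suc[of a "Suc k"] dist_set_insert[OF norm fin ne] by simp
    have opt: "(\<integral>\<^sup>+ x. dist_set N x (insert (a (Suc (Suc k))) (prefix_set a (Suc k))) powr r \<partial>P)
        \<le> (\<integral>\<^sup>+ x. dist_set N x (insert \<xi> (prefix_set a (Suc k))) powr r \<partial>P)" for k \<xi>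
    proof (rule epowr_le_cancel)
      show "0 < 1 / r" using r by simp
      show "epowr (\<integral>\<^sup>+ x. dist_set N x (insert (a (Suc (Suc k))) (prefix_set a (Suc k))) powr r \<partial>P) (1 / r)
          \<le> epowr (\<integral>\<^sup>+ x. dist_set N x (insert \<xi> (prefix_set a (Suc k))) powr r \<partial>P) (1 / r)"
        using greedy[unfolded greedy_seq_def qerr_def, rule_format, of "Suc k" \<xi>] by simp
    qed
    define AA where "AA k = (\<integral>\<^sup>+ x. D k x powr r \<partial>P)" for k
    define II where "II k = (\<integral>\<^sup>+ x. g x * D k x powr (d + r) \<partial>P)" for k
    have step: "AA (Suc k) + ennreal C * II k \<le> AA k" for k
      using greedy_step[OF norm r P nu eps g_meas _ fin a1 g_bound[unfolded d_def], of "a (Suc (Suc k))" k] opt g_nonneg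
      by (simp add: AA_def II_def D_def C_def V_def d_def prefix_set_Suc[of a "Suc k"])
    \<comment> \<open>Finiteness of \<open>AA\<close>, and through the recursion of
      \<open>II\<close>, allows the passage to real sequences.\<close>
    have A_fin: "AA k < \<infinity>" for k
    proof -
      have "AA k \<le> (\<integral>\<^sup>+ x. N (x - a 1) powr r \<partial>P)"
        unfolding AA_def using r D0 dist_set_le[OF norm fin a1]
        by (intro nn_integral_mono ennreal_leI powr_mono2) (auto simp: D_def)
      also have "\<dots> < \<infinity>" by (rule moment_translate_finite[OF norm r P moment])
      finally show ?thesis .
    qed
    have I_fin: "II k < \<infinity>" for k
    proof -
      have "ennreal C * II k \<le> AA k" using step[of k] by (meson add_increasing order_trans zero_le order_refl)
      also have "\<dots> < \<infinity>" by (rule A_fin)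
      finally show ?thesis using C by (auto simp: ennreal_mult_less_top)
    qed
    define A where "A k = enn2real (AA k)" for k
    define I where "I k = enn2real (II k)" for k
    have AA: "AA k = ennreal (A k)" and II: "II k = ennreal (I k)" for k
      using A_fin[of k] I_fin[of k] by (simp_all add: A_def I_def)
    have nonneg: "0 \<le> A k" "0 \<le> I k" for k by (simp_all add: A_def I_def)
    \<comment> \<open>Used twice: with \<open>p = r\<close> to close the recursion, and with
      \<open>p = s\<close> for the final estimate.\<close>
    have interp: "(\<integral>\<^sup>+ x. D k x powr p \<partial>P) \<le> ennreal (I k powr (p / (d + r)) * E powr ((d + r - p) / (d + r)))"
      if "0 < p" "p < d + r" "(\<integral>\<^sup>+ x. negpow g (p / (d + r - p)) x \<partial>P) = ennreal E" "0 \<le> E" for k p E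
      using that D0 g_nonneg II[of k] nonneg(2)
      by (intro nn_integral_powr_le_weighted[where g = g]) (auto simp: II_def)
    \<comment> \<open>The case \<open>\<beta> = r / d\<close>. The index shift turns
      \<open>real n - 1\<close> of the lemma into \<open>real n - 2\<close>, and its condition
      \<open>2 \<le> n\<close> into \<open>3 \<le> n\<close>.\<close>
    have "I (n - 1) \<le> (2 / (C * (real (n - 1) - 1))) powr (1 + r / d) * (r / d) powr (r / d) * G"
    proof (rule dissipation_le[where A = A])
      show "A (Suc k) + C * I k \<le> A k" for k
        using step[of k] C nonneg
        by (simp add: AA II ennreal_mult[symmetric] ennreal_plus[symmetric] del: ennreal_plus)
      show "I (Suc k) \<le> I k" for k
      proof -
        have "II (Suc k) \<le> II k"
          unfolding II_def using r D0 D_Suc g_nonneg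
          by (intro nn_integral_mono ennreal_leI mult_left_mono powr_mono2) auto
        then show ?thesis using nonneg by (simp add: II)
      qed
      show "A k \<le> I k powr ((r / d) / (1 + r / d)) * G powr (1 / (1 + r / d))" for k
      proof -
        have "AA k \<le> ennreal (I k powr (r / (d + r)) * G powr ((d + r - r) / (d + r)))"
          unfolding AA_def using interp[of r G k] r d GH by (simp add: GG_def)
        then have "A k \<le> I k powr (r / (d + r)) * G powr ((d + r - r) / (d + r))"
          by (simp add: AA)
        moreover have "(r / d) / (1 + r / d) = r / (d + r)" "1 / (1 + r / d) = (d + r - r) / (d + r)"
          using d by (simp_all add: field_simps)
        ultimately show ?thesis by (simp only:)
      qed
    qed (use n r d C pos nonneg in auto)
    then have "I (n - 1) \<le> (2 / (C * (real n - 2))) powr (1 + r / d) * (r / d) powr (r / d) * G"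
      using n by (simp add: of_nat_diff)
    \<comment> \<open>Since \<open>1 + r / d = (d + r) / d\<close>, the bound is an exact power with
      exponent \<open>d + r\<close>; its base contains the constant \<open>\<kappa>\<close>.\<close>
    also have "\<dots> = (\<kappa> * (real n - 2) powr (- 1 / d) * G powr (1 / (d + r))) powr (d + r)"
    proof -
      have e: "\<kappa> * (real n - 2) powr (- 1 / d)
          = (2 / (C * (real n - 2))) powr (1 / d) * (r / d) powr (r / (d * (d + r)))"
        using V \<phi> n by (simp add: \<kappa>_def kappa_greedy_def C_def powr_mult powr_divide powr_minus divide_simps)
      have dr: "real d + r \<noteq> 0" using d r by simp
      have "1 / d * (d + r) = 1 + r / d" using d by (simp add: field_simps)
      moreover have "r / (d * (d + r)) * (d + r) = r / d" "1 / (d + r) * (d + r) = 1"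
        using dr by simp_all
      ultimately show ?thesis
        unfolding e using V \<phi> C n r d pos by (simp only: powr_mult powr_powr) simp
    qed
    finally have I_le: "I (n - 1) powr (1 / (d + r)) \<le> \<kappa> * (real n - 2) powr (- 1 / d) * G powr (1 / (d + r))"
      (is "_ \<le> ?R")
    proof -
      assume "I (n - 1) \<le> ?R powr (d + r)"
      then have "I (n - 1) powr (1 / (d + r)) \<le> (?R powr (d + r)) powr (1 / (d + r))"
        using nonneg d r by (intro powr_mono2) auto
      also have "\<dots> = ?R" using \<kappa> d r by (simp add: powr_powr)
      finally show ?thesis .
    qed
    have "qerr N s (prefix_set a n) P = epowr (\<integral>\<^sup>+ x. D (n - 1) x powr s \<partial>P) (1 / s)"
      using n by (simp add: qerr_def D_def)
    \<comment> \<open>After the root \<open>1 / s\<close> the exponent of \<open>I (n - 1)\<close>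
      is \<open>1 / (d + r)\<close>, whatever \<open>s\<close> is, so \<open>I_le\<close> applies
      directly.\<close>
    also have "\<dots> \<le> epowr (ennreal (I (n - 1) powr (s / (d + r)) * H powr ((d + r - s) / (d + r)))) (1 / s)"
      using interp[of s H "n - 1"] r s GH by (intro epowr_mono) (auto simp: HH_def)
    also have "\<dots> = ennreal (I (n - 1) powr (1 / (d + r)) * H powr ((d + r - s) / (s * (d + r))))"
      using r s d by (simp add: epowr_ennreal powr_mult powr_powr mult.commute)
    also have "\<dots> \<le> ennreal (\<kappa> * (real n - 2) powr (- 1 / d) * G powr (1 / (d + r)) * H powr ((d + r - s) / (s * (d + r))))"
      by (intro ennreal_leI mult_right_mono I_le) auto
    also have "\<dots> = ennreal \<kappa> * epowr HH ((d + r - s) / (s * (d + r)))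
        * epowr GG (1 / (d + r)) * ennreal ((real n - 2) powr (- 1 / d))"
      using \<kappa> GH by (simp add: epowr_ennreal ennreal_mult[symmetric] mult_ac)
    finally show "qerr N s (prefix_set a n) P \<le> ennreal \<kappa> * epowr HH ((d + r - s) / (s * (d + r)))
        * epowr GG (1 / (d + r)) * ennreal ((real n - 2) powr (- 1 / d))" .
  qed
qed

end
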